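(* Let $\mathcal{W}=\{W_i^{(l_i)}\}_{i=1}^{n}$ be an optimally spread mixed-rank packing in $\mathbb{F}^m$, where $n\ge m$, $\dim W_i^{(l_i)}=l_i$ and $1\le l_i\le m-1$ for all $i$. Let $$\mathcal{I}:=\{i\in\{1,\dots,n\}:\ W_i^{(l_i)}\text{ achieves the packing constant}\}.$$ Then $\operatorname{span}\{W_i^{(l_i)}: i\in\mathcal{I}\}=\mathbb{F}^m$, i.e. the subspaces $W_i^{(l_i)}$, $i\in\mathcal I$, together span $\mathbb{F}^m$.
   Context: $\mathbb{F}$ is $\mathbb{R}$ or $\mathbb{C}$. A packing in $\mathbb{F}^m$ is a finite sequence of $m\times m$ orthogonal projections, identified with the sequence of their images (subspaces of $\mathbb{F}^m$). It is mixed-rank if at least two different ranks occur among its elements (so the ranks $l_1,\dots,l_n$ are not all equal, but repetitions are allowed). Embedded vectors: for an orthogonal projection $P$ on $\mathbb{F}^m$ of rank $l$, $1\le l\le m-1$, put $v_P=\frac{1}{r_l}\left(P-\frac{l}{m}I_m\right)$ with $r_l=\sqrt{l(m-l)/m}$. This is a unit vector in the real inner product space of traceless symmetric (if $\mathbb{F}=\mathbb{R}$) or Hermitian (if $\mathbb{F}=\mathbb{C}$) $m\times m$ matrices with the Hilbert–Schmidt inner product $\langle A,B\rangle=\operatorname{tr}(AB)$, which is identified isometrically with $\mathbb{R}^{d_{\mathbb{F}^m}}$, where $d_{\mathbb{R}^m}=\frac{m(m+1)}{2}-1$ and $d_{\mathbb{C}^m}=m^2-1$. Let $\mathcal{K}_l$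 be the set of all $v_P$ with $P$ an orthogonal projection of rank $l$ on $\mathbb{F}^m$. A packing $\{P_i\}_{i=1}^n$ with $\operatorname{rank}P_i=l_i$ is optimally spread if $$\max_{i\ne j}\langle v_{P_i},v_{P_j}\rangle=\min_{(u_1,\dots,u_n)\in\mathcal{K}_{l_1}\times\cdots\times\mathcal{K}_{l_n}}\ \max_{i\neq j}\langle u_i,u_j\rangle .$$ In that case $\mu:=\max_{i\neq j}\langle v_{P_i},v_{P_j}\rangle$ is called the packing constant. An element $W_j$ achieves the packing constant if there is some $i\ne j$ such that the inner product of the embedded vectors of (the orthogonal projections onto) $W_j$ and $W_i$ equals $\mu$. *)

theory Defs
  imports "HOL-Analysis.Analysis"
begin

(* The scalar field F, which is the real or the complex numbers.  The class only serves to
   write the definitions below once for both fields. *)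
class real_or_complex = real_normed_field +
  fixes conj :: "'a \<Rightarrow> 'a"
    and re_part :: "'a \<Rightarrow> real"
  assumes conj_add: "conj (x + y) = conj x + conj y"
    and conj_mult: "conj (x * y) = conj x * conj y"
    and conj_conj: "conj (conj x) = x"
    and mult_conj: "x * conj x = (norm x)\<^sup>2 *\<^sub>R 1"
    and add_conj: "x + conj x = (2 * re_part x) *\<^sub>R 1"

instantiation real :: real_or_complex
begin
definition conj_real :: "real \<Rightarrow> real" where "conj_real x = x"
definition re_part_real :: "real \<Rightarrow> real" where "re_part_real x = x"
instance
  by standard (auto simp: conj_real_def re_part_real_def power2_eq_square)
end

instantiation complex :: real_or_complex
begin
definition conj_complex :: "complex \<Rightarrow> complex" where "conj_complex z = cnj z"
definition re_part_complex :: "complex \<Rightarrow> real" where "re_part_complex z = Re z"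
instance
  by standard (auto simp: conj_complex_def re_part_complex_def complex_add_cnj
      scaleR_conv_of_real complex_norm_square[symmetric] simp del: of_real_power)
end

definition conj_transpose :: "'a::real_or_complex ^ 'm ^ 'n \<Rightarrow> 'a ^ 'n ^ 'm" where
  "conj_transpose A = (\<chi> i j. conj (A $ j $ i))"

definition self_adjoint :: "'a::real_or_complex ^ 'm ^ 'm \<Rightarrow> bool" where
  "self_adjoint A \<longleftrightarrow> conj_transpose A = A"

definition orthogonal_proj :: "'a::real_or_complex ^ 'm ^ 'm \<Rightarrow> bool" where
  "orthogonal_proj P \<longleftrightarrow> P ** P = P \<and> self_adjoint P"

(* The Hilbert-Schmidt inner product tr (A B) on self-adjoint matrices.  There the trace is
   real (lemma of_real_hs_inner), so taking the real part only changes the type. *)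
definition hs_inner :: "'a::real_or_complex ^ 'm ^ 'm \<Rightarrow> 'a ^ 'm ^ 'm \<Rightarrow> real" where
  "hs_inner A B = re_part (trace (A ** B))"

lemma conj_zero: "conj (0::'a::real_or_complex) = 0"
  using conj_add[of "0::'a" 0] by simp

lemma conj_sum: "conj (sum f S) = (\<Sum>i\<in>S. conj (f i :: 'a::real_or_complex))"
  by (induction S rule: infinite_finite_induct) (auto simp: conj_zero conj_add)

lemma of_real_hs_inner:
  fixes A B :: "'a::real_or_complex ^ 'm ^ 'm"
  assumes "self_adjoint A" "self_adjoint B"
  shows "of_real (hs_inner A B) = trace (A ** B)"
proof -
  have sym: "conj (A $ i $ j) = A $ j $ i" "conj (B $ i $ j) = B $ j $ i" for i j
    using assms unfolding self_adjoint_def conj_transpose_def vec_eq_iff by auto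
  have "conj (trace (A ** B)) = (\<Sum>i\<in>UNIV. \<Sum>k\<in>UNIV. A $ k $ i * B $ i $ k)"
    by (simp add: trace_def matrix_matrix_mult_def conj_sum conj_mult sym)
  also have "\<dots> = trace (A ** B)"
    by (subst sum.swap) (simp add: trace_def matrix_matrix_mult_def)
  finally have "of_real (2 * re_part (trace (A ** B))) = 2 * trace (A ** B)"
    by (metis add_conj mult_2 of_real_def)
  then show ?thesis
    by (simp add: hs_inner_def)
qed

definition embed_radius :: "nat \<Rightarrow> nat \<Rightarrow> real" where
  "embed_radius m l = sqrt (real l * (real m - real l) / real m)"

(* P made traceless and, for 0 < rank P < m, normalised with respect to hs_inner. *)
definition embed :: "'a::real_or_complex ^ 'm ^ 'm \<Rightarrow> 'a ^ 'm ^ 'm" where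
  "embed P = (1 / embed_radius CARD('m) (rank P)) *\<^sub>R
     (P - (real (rank P) / real CARD('m)) *\<^sub>R mat 1)"

definition embed_proj_set :: "nat \<Rightarrow> ('a::real_or_complex ^ 'm ^ 'm) set" where
  "embed_proj_set l = embed ` {P. orthogonal_proj P \<and> rank P = l}"

(* A Max over the empty set is unspecified, so this is only meaningful for n \<ge> 2;
   a mixed-rank packing always has at least two elements. *)
definition max_inner :: "nat \<Rightarrow> (nat \<Rightarrow> 'a::real_or_complex ^ 'm ^ 'm) \<Rightarrow> real" where
  "max_inner n u = Max {hs_inner (u i) (u j) | i j. i \<in> {1..n} \<and> j \<in> {1..n} \<and> i \<noteq> j}"

(* A packing is a sequence P 1, ..., P n of orthogonal projections; values of P outside
   {1..n} are irrelevant.  The i-th subspace of the packing is the image of P i. *)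
definition packing :: "nat \<Rightarrow> (nat \<Rightarrow> 'a::real_or_complex ^ 'm ^ 'm) \<Rightarrow> bool" where
  "packing n P \<longleftrightarrow> (\<forall>i\<in>{1..n}. orthogonal_proj (P i))"

definition mixed_rank :: "nat \<Rightarrow> (nat \<Rightarrow> 'a::real_or_complex ^ 'm ^ 'm) \<Rightarrow> bool" where
  "mixed_rank n P \<longleftrightarrow> (\<exists>i\<in>{1..n}. \<exists>j\<in>{1..n}. rank (P i) \<noteq> rank (P j))"

definition packing_constant :: "nat \<Rightarrow> (nat \<Rightarrow> 'a::real_or_complex ^ 'm ^ 'm) \<Rightarrow> real" where
  "packing_constant n P = max_inner n (\<lambda>i. embed (P i))"

(* The embedded vectors of a packing themselves belong to the product of these sets, so
   being a lower bound on that product says that the minimum is attained at the packing. *)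
definition optimally_spread :: "nat \<Rightarrow> (nat \<Rightarrow> 'a::real_or_complex ^ 'm ^ 'm) \<Rightarrow> bool" where
  "optimally_spread n P \<longleftrightarrow>
     (\<forall>u :: nat \<Rightarrow> 'a ^ 'm ^ 'm. u \<in> Pi {1..n} (\<lambda>i. embed_proj_set (rank (P i))) \<longrightarrow>
        packing_constant n P \<le> max_inner n u)"

definition achieves_constant :: "nat \<Rightarrow> (nat \<Rightarrow> 'a::real_or_complex ^ 'm ^ 'm) \<Rightarrow> nat \<Rightarrow> bool" where
  "achieves_constant n P j \<longleftrightarrow>
     (\<exists>i\<in>{1..n}. i \<noteq> j \<and> hs_inner (embed (P j)) (embed (P i)) = packing_constant n P)"

end

theory Submission
  imports Defs
begin

text \<open>
  Let \<open>\<mu>\<close> be the packing constant, and call a pair of members tight if the inner product of their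
  embedded vectors is \<open>\<mu>\<close>. If the members of tight pairs do not span the whole space, some unit
  vector \<open>x\<close> is orthogonal to all of them (\<open>exists_common_kernel_vector\<close>). Such an \<open>x\<close> makes it
  possible to take members out of all tight pairs, one after the other, which in the end contradicts
  optimality.

  To free a member \<open>P\<close>, choose a unit vector \<open>f\<close> in its range and turn \<open>f\<close> slightly towards \<open>x\<close>,
  fixing the rest of the range (\<open>rotated_projection\<close>). If \<open>s\<close> is the sine of the angle, then the
  Hilbert-Schmidt inner product with a tight partner \<open>A\<close> of \<open>P\<close>, which annihilates \<open>x\<close>, drops by
  exactly \<open>s\<^sup>2 \<parallel>A f\<parallel>\<^sup>2\<close>, while an inner product that was below its bound stays below it for small
  \<open>s\<close>. If \<open>A P \<noteq> 0\<close> for all tight partners, then a generic \<open>f\<close> in the range of \<open>P\<close> has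
  \<open>A f \<noteq> 0\<close> for all of them, and after the rotation \<open>P\<close> has no tight partner left
  (\<open>rotation_loosens_tight\<close>). No new tight pair appears and ranks are preserved, so the rotated packing
  is again optimal, and \<open>x\<close> is still orthogonal to the members of its tight pairs. The number of tight
  pairs, which is positive for every optimal packing, cannot decrease forever
  (\<open>optimal_common_kernel_trivial\<close>).

  What could fail is a tight pair with \<open>A P = 0\<close>, that is, of orthogonal subspaces. The embedded
  vectors of orthogonal subspaces have inner product at most \<open>-1/(m - 1)\<close>
  (\<open>hs_inner_embed_orthogonal_le\<close>). But \<open>n \<ge> m\<close> unit vectors whose inner products are all at most
  \<open>\<mu> \<le> -1/(m - 1)\<close> form a regular simplex: they sum to zero, and every pair is tight
  (\<open>simplex_of_small_inner_products\<close>). Then \<open>x\<close> is orthogonal to all members of the packing, so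
  each embedded vector maps \<open>x\<close> to a negative multiple of \<open>x\<close>, and their sum cannot be zero
  (\<open>no_orthogonal_tight_pair\<close>).
\<close>

section \<open>Conjugation and real part\<close>

lemma of_real_eq_scaleR_1: "r *\<^sub>R (1::'a::real_or_complex) = of_real r"
  by (simp add: of_real_def)

lemma conj_of_real: "conj (of_real r :: 'a::real_or_complex) = of_real r"
proof (cases "r = 0")
  case False
  have "of_real r * conj (of_real r :: 'a) = of_real r * of_real r"
    using mult_conj[of "of_real r :: 'a"]
    by (simp add: of_real_eq_scaleR_1 power2_eq_square flip: of_real_mult)
  with False show ?thesis by simp
qed (simp add: conj_zero)

lemma conj_scaleR: "conj (r *\<^sub>R x :: 'a::real_or_complex) = r *\<^sub>R conj x"
  by (simp add: scaleR_conv_of_real conj_mult conj_of_real)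

lemma conj_minus: "conj (- x :: 'a::real_or_complex) = - conj x"
  using conj_scaleR[of "-1" x] by simp

lemma conj_diff: "conj (x - y :: 'a::real_or_complex) = conj x - conj y"
  using conj_add[of x "- y"] by (simp add: conj_minus)

lemma conj_one: "conj (1 :: 'a::real_or_complex) = 1"
  using conj_of_real[of 1] by simp

lemma of_real_re_part: "of_real (2 * re_part x) = (x + conj x :: 'a::real_or_complex)"
  by (simp only: add_conj of_real_eq_scaleR_1)

lemma re_part_of_real: "re_part (of_real r :: 'a::real_or_complex) = r"
proof -
  have "(of_real (2 * re_part (of_real r :: 'a)) :: 'a) = of_real (2 * r)"
    by (subst of_real_re_part) (simp add: conj_of_real)
  then show ?thesis unfolding of_real_eq_iff by simp
qed

lemma re_part_add: "re_part (x + y :: 'a::real_or_complex) = re_part x + re_part y"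
proof -
  have "(of_real (2 * re_part (x + y)) :: 'a) = of_real (2 * (re_part x + re_part y))"
    by (simp only: of_real_re_part of_real_add conj_add distrib_left) simp
  then have "2 * re_part (x + y) = 2 * (re_part x + re_part y)" by (simp only: of_real_eq_iff)
  then show ?thesis by simp
qed

lemma re_part_scaleR: "re_part (r *\<^sub>R x :: 'a::real_or_complex) = r * re_part x"
proof -
  have "(of_real (2 * re_part (r *\<^sub>R x)) :: 'a) = of_real r * of_real (2 * re_part x)"
    by (simp only: of_real_re_part conj_scaleR) (simp add: scaleR_conv_of_real distrib_left)
  also have "\<dots> = of_real (2 * (r * re_part x))" by simp
  finally show ?thesis unfolding of_real_eq_iff by simp
qed

section \<open>The Hilbert-Schmidt inner product\<close>

lemma linear_hs_inner_right: "linear (hs_inner (A :: 'a::real_or_complex ^ 'm ^ 'm))"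
proof (rule linearI)
  fix B C :: "'a ^ 'm ^ 'm" and r :: real
  show "hs_inner A (B + C) = hs_inner A B + hs_inner A C"
    by (simp add: hs_inner_def matrix_add_ldistrib trace_add re_part_add)
  have "trace (A ** (r *\<^sub>R B)) = r *\<^sub>R trace (A ** B)"
    by (simp add: trace_def matrix_matrix_mult_def scaleR_sum_right)
  then show "hs_inner A (r *\<^sub>R B) = r *\<^sub>R hs_inner A B"
    by (simp add: hs_inner_def re_part_scaleR)
qed

lemmas hs_inner_add_right = linear_add[OF linear_hs_inner_right]
  and hs_inner_diff_right = linear_diff[OF linear_hs_inner_right]
  and hs_inner_scaleR_right = linear_scale[OF linear_hs_inner_right]
  and hs_inner_sum_right = linear_sum[OF linear_hs_inner_right]

lemma hs_inner_commute: "hs_inner A B = hs_inner B (A :: 'a::real_or_complex ^ 'm ^ 'm)"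
  unfolding hs_inner_def by (subst trace_mul_sym) (rule refl)

lemma hs_inner_diff_left:
  "hs_inner (A - B) C = hs_inner A C - hs_inner B (C :: 'a::real_or_complex ^ 'm ^ 'm)"
  using hs_inner_diff_right[of C A B] by (metis hs_inner_commute)

lemma hs_inner_scaleR_left:
  "hs_inner (r *\<^sub>R A) C = r * hs_inner A (C :: 'a::real_or_complex ^ 'm ^ 'm)"
  using hs_inner_scaleR_right[of C r A] by (metis hs_inner_commute real_scaleR_def)

lemma hs_inner_sum_left:
  "hs_inner (sum f S) C = (\<Sum>i\<in>S. hs_inner (f i) (C :: 'a::real_or_complex ^ 'm ^ 'm))"
  by (subst hs_inner_commute) (simp add: hs_inner_sum_right hs_inner_commute[of C])

lemma self_adjoint_nth: "self_adjoint A \<longleftrightarrow> (\<forall>i j. conj (A $ i $ j) = A $ j $ i)"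
  by (auto simp: self_adjoint_def conj_transpose_def vec_eq_iff)

lemma hs_inner_self:
  fixes A :: "'a::real_or_complex ^ 'm ^ 'm"
  assumes "self_adjoint A"
  shows "hs_inner A A = (\<Sum>i\<in>UNIV. (norm (A $ i))\<^sup>2)"
proof -
  have "trace (A ** A) = (\<Sum>i\<in>UNIV. \<Sum>k\<in>UNIV. A $ i $ k * conj (A $ i $ k))"
    using assms by (simp add: trace_def matrix_matrix_mult_def self_adjoint_nth)
  also have "\<dots> = of_real (\<Sum>i\<in>UNIV. \<Sum>k\<in>UNIV. (norm (A $ i $ k))\<^sup>2)"
    by (simp add: mult_conj of_real_eq_scaleR_1)
  finally show ?thesis
    by (simp add: hs_inner_def re_part_of_real norm_vec_def L2_set_def sum_nonneg del: of_real_sum)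
qed

lemma hs_inner_self_nonneg: "self_adjoint A \<Longrightarrow> 0 \<le> hs_inner A A"
  by (simp add: hs_inner_self sum_nonneg)

lemma hs_inner_self_eq_0: "self_adjoint A \<Longrightarrow> hs_inner A A = 0 \<Longrightarrow> A = 0"
  by (simp add: hs_inner_self sum_nonneg_eq_0_iff vec_eq_iff)

section \<open>Trace and rank of a projection\<close>

text \<open>Let \<open>B\<close> be a basis of the row space. Idempotence says that multiplication by \<open>P\<close> from the right
  fixes \<open>B\<close>, so expanding the rows of \<open>P\<close> in \<open>B\<close> lets each element of \<open>B\<close> contribute 1 to the
  trace. This is the reason why trace-preserving changes of a projection preserve its rank.\<close>

lemma trace_idempotent_eq_rank:
  fixes P :: "'a::field ^ 'm ^ 'm"
  assumes "P ** P = P"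
  shows "trace P = of_nat (rank P)"
proof -
  obtain B where B: "B \<subseteq> rows P" "vec.independent B" "rows P \<subseteq> vec.span B" "card B = vec.dim (rows P)"
    using vec.basis_exists[of "rows P"] by metis
  have fin: "finite B" using B(2) vec.finiteI_independent by blast
  let ?\<phi> = "vec.representation B"
  have row: "row k P \<in> vec.span B" for k
    using B(3) by (auto simp: rows_def)
  have fixed: "(\<Sum>k\<in>UNIV. b $ k *s row k P) = b" if bB: "b \<in> B" for b
  proof -
    obtain j where b: "b = row j P" using bB B(1) unfolding rows_def by blast
    have "(P ** P) $ j = P $ j" using assms by simp
    then show ?thesis
      by (simp add: b vec_eq_iff row_def matrix_matrix_mult_def)
  qed
  have expand: "(\<Sum>b\<in>B. ?\<phi> (row k P) b *s b) = row k P" for k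
    by (rule vec.sum_representation_eq[OF B(2) row fin order_refl])
  have "trace P = (\<Sum>k\<in>UNIV. (\<Sum>b\<in>B. ?\<phi> (row k P) b *s b) $ k)"
    unfolding expand by (simp add: trace_def row_def)
  also have "\<dots> = (\<Sum>b\<in>B. \<Sum>k\<in>UNIV. b $ k * ?\<phi> (row k P) b)"
    by (subst sum.swap) (simp add: mult.commute)
  also have "\<dots> = (\<Sum>b\<in>B. ?\<phi> (\<Sum>k\<in>UNIV. b $ k *s row k P) b)"
    using row by (simp add: vec.representation_sum[OF B(2)] vec.representation_scale[OF B(2)] vec.span_scale)
  also have "\<dots> = (\<Sum>b\<in>B. 1)"
    by (intro sum.cong refl) (simp add: fixed vec.representation_basis[OF B(2)])
  finally show ?thesis using B(4) by (simp add: row_rank_def_gen)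
qed

section \<open>Rank-one perturbations of projections\<close>

lemma scaleR_matrix_mult_vector: "(c *\<^sub>R A) *v x = c *\<^sub>R (A *v (x :: 'a::real_algebra_1 ^ 'm))"
  by (simp add: matrix_vector_mult_def vec_eq_iff scaleR_sum_right)

text \<open>The rank-one matrix \<open>u v\<^sup>*\<close>.\<close>

definition outer :: "'a::real_or_complex ^ 'm \<Rightarrow> 'a ^ 'm \<Rightarrow> 'a ^ 'm ^ 'm" where
  "outer u v = (\<chi> i j. u $ i * conj (v $ j))"

lemma outer_add_left: "outer (u + v) w = outer u w + outer v w"
  by (simp add: outer_def vec_eq_iff distrib_right)

lemma outer_add_right: "outer w (u + v) = outer w u + outer w v"
  by (simp add: outer_def vec_eq_iff distrib_left conj_add)

lemma outer_scaleR_left: "outer (r *\<^sub>R u) v = r *\<^sub>R outer u v"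
  by (simp add: outer_def vec_eq_iff)

lemma outer_scaleR_right: "outer u (r *\<^sub>R v) = r *\<^sub>R outer u v"
  by (simp add: outer_def vec_eq_iff conj_scaleR)

lemma outer_zero: "outer 0 v = 0" "outer u 0 = 0"
  by (simp_all add: outer_def vec_eq_iff conj_zero)

lemma self_adjoint_outer_self: "self_adjoint (outer u u)"
  by (simp add: self_adjoint_nth outer_def conj_mult conj_conj mult.commute)

lemma matrix_mult_outer: "A ** outer u v = outer (A *v u) v"
  by (simp add: matrix_matrix_mult_def matrix_vector_mult_def outer_def vec_eq_iff
      sum_distrib_right mult.assoc)

lemma outer_mult_matrix: "self_adjoint A \<Longrightarrow> outer u v ** A = outer u (A *v v)"
  by (simp add: matrix_matrix_mult_def matrix_vector_mult_def outer_def vec_eq_iff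
      sum_distrib_left conj_sum conj_mult self_adjoint_nth ac_simps)

lemma sum_mult_conj: "(\<Sum>i\<in>UNIV. u $ i * conj (u $ i)) = of_real ((norm u)\<^sup>2)"
  for u :: "'a::real_or_complex ^ 'm"
  by (simp add: mult_conj of_real_eq_scaleR_1 norm_vec_def L2_set_def sum_nonneg
      flip: of_real_sum of_real_power)

lemma trace_outer_self: "trace (outer u u) = of_real ((norm u)\<^sup>2)"
  by (simp add: trace_def outer_def sum_mult_conj del: of_real_power)

lemma outer_mult_vector: "outer u v *v w = trace (outer w v) *s u"
  by (simp add: outer_def matrix_vector_mult_def trace_def vec_eq_iff sum_distrib_left ac_simps)

lemma outer_self_idempotent: "norm u = 1 \<Longrightarrow> outer u u ** outer u u = outer u u"
  by (simp add: matrix_mult_outer outer_mult_vector trace_outer_self)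

text \<open>Since \<open>A = A A\<close>, cyclicity of the trace turns \<open>A u u\<^sup>*\<close> into \<open>(A u) (A u)\<^sup>*\<close>.\<close>

lemma hs_inner_outer_self:
  assumes "orthogonal_proj A"
  shows "hs_inner A (outer u u) = (norm (A *v u))\<^sup>2"
proof -
  have sa: "self_adjoint A" and id: "A ** A = A" using assms by (auto simp: orthogonal_proj_def)
  have "trace (A ** outer u u) = trace (A ** (A ** outer u u))"
    by (simp add: matrix_mul_assoc id)
  also have "\<dots> = trace ((A ** outer u u) ** A)" by (rule trace_mul_sym)
  also have "\<dots> = of_real ((norm (A *v u))\<^sup>2)"
    by (simp only: matrix_mult_outer outer_mult_matrix[OF sa] trace_outer_self)
  finally show ?thesis by (simp only: hs_inner_def re_part_of_real)
qed

lemma orthogonal_proj_add_outer: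
  assumes "orthogonal_proj P" "P *v g = 0" "norm g = 1"
  shows "orthogonal_proj (P + outer g g)"
proof -
  have sa: "self_adjoint P" and id: "P ** P = P" using assms by (auto simp: orthogonal_proj_def)
  have "(P + outer g g) ** (P + outer g g) = P ** P + P ** outer g g + outer g g ** P + outer g g ** outer g g"
    by (simp add: matrix_matrix_mult_def vec_eq_iff algebra_simps sum.distrib)
  also have "\<dots> = P + outer g g"
    by (simp add: id matrix_mult_outer[of P]
        outer_mult_matrix[OF sa] assms(2) outer_zero outer_self_idempotent[OF assms(3)])
  finally have "(P + outer g g) ** (P + outer g g) = P + outer g g" .
  moreover have "self_adjoint (P + outer g g)"
    using sa self_adjoint_outer_self[of g] by (simp add: self_adjoint_nth conj_add)
  ultimately show ?thesis by (simp add: orthogonal_proj_def)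
qed

lemma orthogonal_proj_diff_outer:
  assumes "orthogonal_proj P" "P *v f = f" "norm f = 1"
  shows "orthogonal_proj (P - outer f f)"
proof -
  have sa: "self_adjoint P" and id: "P ** P = P" using assms by (auto simp: orthogonal_proj_def)
  have "(P - outer f f) ** (P - outer f f) = P ** P - P ** outer f f - outer f f ** P + outer f f ** outer f f"
    by (simp add: matrix_matrix_mult_def vec_eq_iff algebra_simps sum.distrib sum_subtractf)
  also have "\<dots> = P - outer f f"
    by (simp add: id matrix_mult_outer[of P] outer_mult_matrix[OF sa] assms(2)
        outer_self_idempotent[OF assms(3)])
  finally have "(P - outer f f) ** (P - outer f f) = P - outer f f" .
  moreover have "self_adjoint (P - outer f f)"
    using sa self_adjoint_outer_self[of f] by (simp add: self_adjoint_nth conj_diff)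
  ultimately show ?thesis by (simp add: orthogonal_proj_def)
qed

text \<open>\<open>Q\<close> arises from \<open>P\<close> by replacing the unit vector \<open>f\<close> of the range with the unit vector
  \<open>g = c f + s x\<close>, that is, \<open>Q = (P - f f\<^sup>*) + g g\<^sup>*\<close>. It is written as a combination of fixed
  matrices, so that the linearity of the inner product makes its dependence on \<open>s\<close> explicit.\<close>

lemma rotated_projection:
  fixes P :: "'a::real_or_complex ^ 'm ^ 'm"
  assumes P: "orthogonal_proj P" and f: "P *v f = f" "norm f = 1"
    and x: "P *v x = 0" "norm x = 1" and cs: "c\<^sup>2 + s\<^sup>2 = 1"
  defines "Q \<equiv> P + s\<^sup>2 *\<^sub>R (outer x x - outer f f) + (c * s) *\<^sub>R (outer f x + outer x f)"
  shows "orthogonal_proj Q" "rank Q = rank P"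
proof -
  have sa: "self_adjoint P" and id: "P ** P = P" using P by (auto simp: orthogonal_proj_def)
  \<comment> \<open>\<open>f\<close> and \<open>x\<close> are orthogonal because \<open>P\<close> fixes one and annihilates the other; hence the mixed
    traces below vanish and \<open>g\<close> has norm 1.\<close>
  define g where "g = c *\<^sub>R f + s *\<^sub>R x"
  have g: "outer g g = c\<^sup>2 *\<^sub>R outer f f + s\<^sup>2 *\<^sub>R outer x x + (c * s) *\<^sub>R (outer f x + outer x f)"
    by (simp add: g_def outer_add_left outer_add_right outer_scaleR_left outer_scaleR_right
        algebra_simps power2_eq_square)
  have "c\<^sup>2 *\<^sub>R outer f f = outer f f - s\<^sup>2 *\<^sub>R outer f f"
    using cs by (metis add_diff_cancel_right' scaleR_left_diff_distrib scaleR_one)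
  then have Q: "Q = (P - outer f f) + outer g g"
    by (simp add: Q_def g algebra_simps)
  have "trace (outer f x) = trace (P ** outer f x)"
    by (simp add: matrix_mult_outer f)
  also have "\<dots> = 0"
    by (subst trace_mul_sym) (simp add: outer_mult_matrix[OF sa] x outer_zero trace_def)
  finally have fx: "trace (outer f x) = 0" .
  have "trace (outer x f) = trace (outer x f ** P)"
    by (simp add: outer_mult_matrix[OF sa] f)
  also have "\<dots> = 0"
    by (subst trace_mul_sym) (simp add: matrix_mult_outer x outer_zero trace_def)
  finally have xf: "trace (outer x f) = 0" .
  have tr: "trace (r *\<^sub>R A) = r *\<^sub>R trace A" for r and A :: "'a ^ 'm ^ 'm"
    by (simp add: trace_def scaleR_sum_right)
  have "(of_real ((norm g)\<^sup>2) :: 'a) = c\<^sup>2 *\<^sub>R 1 + s\<^sup>2 *\<^sub>R 1"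
    unfolding trace_outer_self[symmetric] g
    by (simp add: trace_add tr fx xf trace_outer_self f x)
  also have "\<dots> = of_real 1"
    unfolding scaleR_left_distrib[symmetric] cs by simp
  finally have "norm g = 1"
    unfolding of_real_eq_iff using norm_ge_zero[of g] by (simp only: power2_eq_1_iff) linarith
  have "(P - outer f f) *v f = 0" "(P - outer f f) *v x = 0"
    by (simp_all add: matrix_vector_mult_diff_rdistrib f x outer_mult_vector trace_outer_self xf)
  then have "(P - outer f f) *v g = 0"
    by (simp add: g_def linear_add[OF matrix_vector_mul_linear] linear_scale[OF matrix_vector_mul_linear])
  then show "orthogonal_proj Q"
    unfolding Q
    by (intro orthogonal_proj_add_outer orthogonal_proj_diff_outer P f \<open>norm g = 1\<close>)
  then have "of_nat (rank Q) = trace Q"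
    by (simp add: trace_idempotent_eq_rank orthogonal_proj_def)
  also have "\<dots> = trace P"
    by (simp add: Q trace_add trace_sub trace_outer_self f \<open>norm g = 1\<close>)
  also have "\<dots> = of_nat (rank P)"
    by (simp add: trace_idempotent_eq_rank id)
  finally show "rank Q = rank P" by simp
qed

section \<open>A direction orthogonal to a proper span\<close>

text \<open>The orthogonal complement of the span comes from a linear functional that vanishes on it: the
  conjugated coefficients of such a functional form a vector \<open>y\<close>, and self-adjointness turns
  vanishing on the range of \<open>P i\<close> into \<open>P i y = 0\<close>.\<close>

lemma exists_common_kernel_vector:
  fixes P :: "'i \<Rightarrow> 'a::real_or_complex ^ 'm ^ 'm"
  assumes sa: "\<And>i. i \<in> I \<Longrightarrow> self_adjoint (P i)"
    and proper: "vec.span (\<Union>i\<in>I. range ((*v) (P i))) \<noteq> UNIV"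
  shows "\<exists>x. norm x = 1 \<and> (\<forall>i\<in>I. P i *v x = 0)"
proof -
  define V where "V = (\<Union>i\<in>I. range ((*v) (P i)))"
  obtain u where u: "u \<notin> vec.span V" using proper by (auto simp: V_def)
  obtain B where B: "B \<subseteq> V" "vec.independent B" "V \<subseteq> vec.span B"
    using vec.maximal_independent_subset[of V] by blast
  have "vec.span B \<subseteq> vec.span V" using B(1) by (rule vec.span_mono)
  with u have uB: "u \<notin> vec.span B" by blast
  have "vec.independent (insert u B)"
    using uB B(2) by (metis vec.independent_insert vec.span_base)
  then obtain g where g: "Vector_Spaces.linear (*s) (*s) g"
      "\<And>b. b \<in> insert u B \<Longrightarrow> g b = (if b = u then u else 0)"
    using vec.linear_independent_extend[of "insert u B" "\<lambda>b. if b = u then u else 0"] by blast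
  \<comment> \<open>\<open>g\<close> vanishes on \<open>V\<close> and fixes \<open>u \<noteq> 0\<close>, so some row of its matrix is a nonzero functional
    that vanishes on \<open>V\<close>.\<close>
  have "g v = 0" if "v \<in> V" for v
  proof -
    have "v \<in> vec.span B" using that B(3) by blast
    moreover have "g b = 0" if "b \<in> B" for b
      using g(2)[of b] that uB vec.span_base[of b B] by auto
    ultimately show ?thesis
      using vec.linear_eq_0_on_span[OF g(1)] by blast
  qed
  then have gV: "matrix g *v v = 0" if "v \<in> V" for v
    using that by (simp add: matrix_works[OF g(1)])
  have "matrix g *v u = u" using g by (simp add: matrix_works[OF g(1)])
  moreover have "u \<noteq> 0" using u vec.span_zero by blast
  ultimately have "matrix g \<noteq> 0" by (auto simp: matrix_vector_mult_0)
  then obtain k where k: "matrix g $ k \<noteq> 0" by (auto simp: vec_eq_iff)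
  define y where "y = (\<chi> j. conj (matrix g $ k $ j))"
  obtain j where "matrix g $ k $ j \<noteq> 0" using k by (auto simp: vec_eq_iff)
  then have "y $ j \<noteq> 0" by (metis y_def vec_lambda_beta conj_conj conj_zero)
  then have "y \<noteq> 0" by auto
  have Py: "P i *v y = 0" if i: "i \<in> I" for i
  proof -
    have "conj ((P i *v y) $ r) = (\<Sum>q\<in>UNIV. matrix g $ k $ q * P i $ q $ r)" for r
      using sa[OF i]
      by (simp add: matrix_vector_mult_def y_def conj_sum conj_mult conj_conj self_adjoint_nth mult.commute)
    moreover have "(\<Sum>q\<in>UNIV. matrix g $ k $ q * P i $ q $ r) = (matrix g *v (P i *v axis r 1)) $ k" for r
      by (simp add: matrix_vector_mult_def axis_def if_distrib cong: if_cong)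
    ultimately have "conj ((P i *v y) $ r) = (matrix g *v (P i *v axis r 1)) $ k" for r by simp
    moreover have "matrix g *v (P i *v axis r 1) = 0" for r
      by (rule gV) (use i in \<open>auto simp: V_def\<close>)
    ultimately have "conj ((P i *v y) $ r) = 0" for r by simp
    then show ?thesis by (metis conj_conj conj_zero vec_eq_iff zero_index)
  qed
  have "norm (y /\<^sub>R norm y) = 1" using \<open>y \<noteq> 0\<close> by simp
  moreover have "P i *v (y /\<^sub>R norm y) = 0" if "i \<in> I" for i
    using Py[OF that] by (simp add: linear_scale[OF matrix_vector_mul_linear])
  ultimately show ?thesis by blast
qed

section \<open>Rotating a projection away from its tight neighbours\<close>

text \<open>A space over an infinite field is not a finite union of proper subspaces. In the inductive step, a
  vector that is good for all earlier matrices stays good under small perturbations, and a perturbation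
  along a vector outside the new kernel makes it good for the new matrix, too.\<close>

lemma exists_vector_avoiding_kernels:
  fixes M :: "'i \<Rightarrow> 'a::real_normed_field ^ 'm ^ 'm"
  assumes "finite K" "\<And>k. k \<in> K \<Longrightarrow> M k \<noteq> 0"
  shows "\<exists>y. \<forall>k\<in>K. M k *v y \<noteq> 0"
  using assms
proof (induction K)
  case (insert k K)
  then obtain y where y: "\<And>k'. k' \<in> K \<Longrightarrow> M k' *v y \<noteq> 0" by auto
  show ?case
  proof (cases "M k *v y = 0")
    case True
    obtain h where h: "M k *v h \<noteq> 0"
      using insert.prems[of k] by (auto simp: matrix_eq)
    have lin: "M k' *v (y + e *\<^sub>R h) = M k' *v y + e *\<^sub>R (M k' *v h)" for k' e
      by (simp add: linear_add[OF matrix_vector_mul_linear] linear_scale[OF matrix_vector_mul_linear])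
    have "\<forall>\<^sub>F e in at_right 0. M k' *v (y + e *\<^sub>R h) \<noteq> 0" if "k' \<in> K" for k'
    proof (rule tendsto_imp_eventually_ne)
      have "((\<lambda>e. M k' *v (y + e *\<^sub>R h)) \<longlongrightarrow> M k' *v y + 0 *\<^sub>R (M k' *v h)) (at_right 0)"
        unfolding lin by (intro tendsto_intros)
      then show "((\<lambda>e. M k' *v (y + e *\<^sub>R h)) \<longlongrightarrow> M k' *v y) (at_right 0)" by simp
    qed (rule y[OF that])
    then have "\<forall>\<^sub>F e in at_right 0. \<forall>k'\<in>K. M k' *v (y + e *\<^sub>R h) \<noteq> 0"
      using insert.hyps by (intro eventually_ball_finite) auto
    moreover have "\<forall>\<^sub>F e in at_right 0. 0 < (e::real)"
      by (rule eventually_at_right_less)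
    ultimately have "\<forall>\<^sub>F e in at_right 0. 0 < e \<and> (\<forall>k'\<in>K. M k' *v (y + e *\<^sub>R h) \<noteq> 0)"
      by eventually_elim blast
    then obtain e where e: "0 < e" "\<forall>k'\<in>K. M k' *v (y + e *\<^sub>R h) \<noteq> 0"
      using eventually_happens'[OF trivial_limit_at_right_real] by blast
    have "M k *v (y + e *\<^sub>R h) \<noteq> 0" using True h e(1) by (simp add: lin)
    with e(2) show ?thesis by blast
  qed (use y in blast)
qed simp

text \<open>Turn a generic unit vector \<open>f\<close> of the range of \<open>P\<close> towards \<open>x\<close>. The inner product with \<open>A k\<close>
  is continuous in the angle, which settles the bounds that are strict for \<open>P\<close>. Where the bound is
  attained, \<open>A k\<close> annihilates \<open>x\<close>, so the first-order term vanishes and the second-order term is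
  strictly negative.\<close>

lemma rotation_loosens_tight:
  fixes P :: "'a::real_or_complex ^ 'm ^ 'm" and A :: "'i \<Rightarrow> 'a ^ 'm ^ 'm"
  assumes P: "orthogonal_proj P" "P \<noteq> 0"
    and A: "\<And>k. k \<in> K \<Longrightarrow> orthogonal_proj (A k)" and "finite K"
    and le: "\<And>k. k \<in> K \<Longrightarrow> hs_inner (A k) P \<le> t k"
    and x: "norm x = 1" "P *v x = 0"
    and tight: "\<And>k. k \<in> K \<Longrightarrow> hs_inner (A k) P = t k \<Longrightarrow> A k *v x = 0"
    and meet: "\<And>k. k \<in> K \<Longrightarrow> hs_inner (A k) P = t k \<Longrightarrow> A k ** P \<noteq> 0"
  shows "\<exists>Q. orthogonal_proj Q \<and> rank Q = rank P \<and> (\<forall>k\<in>K. hs_inner (A k) Q < t k)"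
proof -
  define T where "T = {k \<in> K. hs_inner (A k) P = t k}"
  \<comment> \<open>Including \<open>P\<close> itself makes the projected vector nonzero even if no bound is attained.\<close>
  have "\<exists>z. \<forall>M\<in>insert P ((\<lambda>k. A k ** P) ` T). M *v z \<noteq> 0"
    by (rule exists_vector_avoiding_kernels) (use \<open>finite K\<close> P(2) meet in \<open>auto simp: T_def\<close>)
  then obtain z where z: "\<forall>M\<in>insert P ((\<lambda>k. A k ** P) ` T). M *v z \<noteq> 0" ..
  define y where "y = P *v z"
  have "y \<noteq> 0" using z by (simp add: y_def)
  have Py: "P *v y = y"
    using P by (simp add: y_def matrix_vector_mul_assoc orthogonal_proj_def)
  define f where "f = y /\<^sub>R norm y"
  have f: "P *v f = f" "norm f = 1"
    using \<open>y \<noteq> 0\<close> by (simp_all add: f_def linear_scale[OF matrix_vector_mul_linear] Py)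
  have Af: "A k *v f \<noteq> 0" if "k \<in> K" "hs_inner (A k) P = t k" for k
    using z that \<open>y \<noteq> 0\<close>
    by (auto simp: T_def f_def y_def linear_scale[OF matrix_vector_mul_linear] matrix_vector_mul_assoc)
  define c where "c s = sqrt (1 - s\<^sup>2)" for s :: real
  define Q where "Q s = P + s\<^sup>2 *\<^sub>R (outer x x - outer f f) + (c s * s) *\<^sub>R (outer f x + outer x f)" for s
  have hs: "hs_inner (A k) (Q s) = hs_inner (A k) P
      + s\<^sup>2 * (hs_inner (A k) (outer x x) - hs_inner (A k) (outer f f))
      + c s * s * hs_inner (A k) (outer f x + outer x f)" for k s
    by (simp add: Q_def hs_inner_add_right hs_inner_diff_right hs_inner_scaleR_right)
  have hs_tight: "hs_inner (A k) (Q s) = t k - s\<^sup>2 * (norm (A k *v f))\<^sup>2"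
    if k: "k \<in> K" "hs_inner (A k) P = t k" for k s
  proof -
    have Ax: "A k *v x = 0" using tight k by blast
    have sa: "self_adjoint (A k)" using A[OF k(1)] by (simp add: orthogonal_proj_def)
    have "hs_inner (A k) (outer x f) = 0"
      by (simp add: hs_inner_def matrix_mult_outer Ax outer_zero trace_def re_part_of_real[of 0, simplified])
    moreover have "hs_inner (A k) (outer f x) = 0"
      unfolding hs_inner_commute[of "A k"]
      by (simp add: hs_inner_def outer_mult_matrix[OF sa] Ax outer_zero trace_def re_part_of_real[of 0, simplified])
    ultimately show ?thesis
      using k by (simp add: hs hs_inner_outer_self[OF A[OF k(1)]] Ax hs_inner_add_right)
  qed
  have "\<forall>\<^sub>F s in at_right 0. hs_inner (A k) P < t k \<longrightarrow> hs_inner (A k) (Q s) < t k" for k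
  proof (cases "hs_inner (A k) P < t k")
    case True
    have "((\<lambda>s. hs_inner (A k) (Q s)) \<longlongrightarrow> hs_inner (A k) P
      + 0\<^sup>2 * (hs_inner (A k) (outer x x) - hs_inner (A k) (outer f f))
      + sqrt (1 - 0\<^sup>2) * 0 * hs_inner (A k) (outer f x + outer x f)) (at_right 0)"
      unfolding hs c_def by (intro tendsto_intros)
    then have "((\<lambda>s. hs_inner (A k) (Q s)) \<longlongrightarrow> hs_inner (A k) P) (at_right 0)" by simp
    then have "\<forall>\<^sub>F s in at_right 0. hs_inner (A k) (Q s) < t k"
      using True by (rule order_tendstoD)
    then show ?thesis by eventually_elim simp
  qed simp
  then have "\<forall>\<^sub>F s in at_right 0. \<forall>k\<in>K. hs_inner (A k) P < t k \<longrightarrow> hs_inner (A k) (Q s) < t k"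
    using \<open>finite K\<close> by (intro eventually_ball_finite) auto
  moreover have "\<forall>\<^sub>F s in at_right 0. 0 < s \<and> s < (1::real)"
    by (auto simp: eventually_at_right[of 0 1] intro: exI[of _ 1])
  ultimately have "\<forall>\<^sub>F s in at_right 0. (0 < s \<and> s < (1::real)) \<and>
      (\<forall>k\<in>K. hs_inner (A k) P < t k \<longrightarrow> hs_inner (A k) (Q s) < t k)"
    by eventually_elim blast
  then obtain s where s: "0 < s" "s < 1"
    "\<And>k. k \<in> K \<Longrightarrow> hs_inner (A k) P < t k \<Longrightarrow> hs_inner (A k) (Q s) < t k"
    using eventually_happens'[OF trivial_limit_at_right_real] by blast
  have "(c s)\<^sup>2 + s\<^sup>2 = 1"
    using s by (simp add: c_def power_le_one)
  then have Q: "orthogonal_proj (Q s)" "rank (Q s) = rank P"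
    unfolding Q_def using rotated_projection[OF P(1) f x(2,1)] by blast+
  have "hs_inner (A k) (Q s) < t k" if k: "k \<in> K" for k
  proof (cases "hs_inner (A k) P = t k")
    case True
    then show ?thesis using hs_tight[OF k] Af[OF k] s(1) by simp
  next
    case False
    then show ?thesis using s(3)[OF k] le[OF k] by simp
  qed
  with Q show ?thesis by blast
qed

section \<open>Unit vectors that are as far apart as a simplex\<close>

text \<open>Each row of the Gram matrix sums to at most \<open>1 + (card S - 1) \<mu> \<le> 0\<close>, whereas the sum of all its
  entries is the squared length of \<open>sum v S\<close>. Hence all these inequalities are equalities.\<close>

lemma simplex_of_small_inner_products:
  fixes v :: "'i \<Rightarrow> 'a::real_or_complex ^ 'm ^ 'm"
  assumes sa: "\<And>i. i \<in> S \<Longrightarrow> self_adjoint (v i)" and "finite S"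
    and unit: "\<And>i. i \<in> S \<Longrightarrow> hs_inner (v i) (v i) = 1"
    and le: "\<And>i j. i \<in> S \<Longrightarrow> j \<in> S \<Longrightarrow> i \<noteq> j \<Longrightarrow> hs_inner (v i) (v j) \<le> \<mu>"
    and \<mu>: "1 + real (card S - 1) * \<mu> \<le> 0"
  shows "sum v S = 0" and "\<And>i j. i \<in> S \<Longrightarrow> j \<in> S \<Longrightarrow> i \<noteq> j \<Longrightarrow> hs_inner (v i) (v j) = \<mu>"
proof -
  have row_sum: "hs_inner (v i) (sum v S) = 1 + (\<Sum>j\<in>S - {i}. hs_inner (v i) (v j))" if "i \<in> S" for i
    using that \<open>finite S\<close> by (simp add: hs_inner_sum_right sum.remove[of S i "\<lambda>j. hs_inner (v i) (v j)"] unit)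
  have row: "hs_inner (v i) (sum v S) \<le> 0" if "i \<in> S" for i
  proof -
    have "(\<Sum>j\<in>S - {i}. hs_inner (v i) (v j)) \<le> real (card (S - {i})) * \<mu>"
      using le that by (intro sum_bounded_above) auto
    also have "\<dots> = real (card S - 1) * \<mu>" using that by (simp only: card_Diff_singleton)
    finally show ?thesis using \<mu> row_sum[OF that] by linarith
  qed
  have saS: "self_adjoint (sum v S)"
    using sa by (simp add: self_adjoint_nth conj_sum)
  have "hs_inner (sum v S) (sum v S) \<le> 0"
    using row by (simp add: hs_inner_sum_left sum_nonpos)
  then show 0: "sum v S = 0"
    using hs_inner_self_eq_0[OF saS] hs_inner_self_nonneg[OF saS] by simp
  fix i j assume ij: "i \<in> S" "j \<in> S" "i \<noteq> j"
  have "(\<Sum>j\<in>S - {i}. \<mu> - hs_inner (v i) (v j)) = real (card (S - {i})) * \<mu> - (hs_inner (v i) (sum v S) - 1)"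
    using ij by (simp add: row_sum sum_subtractf del: card_Diff_singleton)
  also have "\<dots> = 1 + real (card S - 1) * \<mu>"
    unfolding 0 linear_0[OF linear_hs_inner_right] card_Diff_singleton[OF ij(1)] by simp
  also note \<mu>
  finally have "(\<Sum>j\<in>S - {i}. \<mu> - hs_inner (v i) (v j)) = 0"
    using le ij by (intro antisym sum_nonneg) auto
  then have "\<mu> - hs_inner (v i) (v j) = 0"
    using \<open>finite S\<close> le ij by (subst (asm) sum_nonneg_eq_0_iff) auto
  then show "hs_inner (v i) (v j) = \<mu>" by simp
qed

section \<open>Embedded vectors\<close>

lemma hs_inner_mat_1_right: "orthogonal_proj P \<Longrightarrow> hs_inner P (mat 1) = real (rank P)"
  using trace_idempotent_eq_rank[of P] re_part_of_real[of "real (rank P)"]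
  by (simp add: hs_inner_def orthogonal_proj_def)

lemma hs_inner_mat_1_self: "hs_inner (mat 1) (mat 1 :: 'a::real_or_complex ^ 'm ^ 'm) = real CARD('m)"
  using re_part_of_real[of "real CARD('m)", where ?'a = 'a] by (simp add: hs_inner_def trace_I)

lemma hs_inner_embed:
  fixes P Q :: "'a::real_or_complex ^ 'm ^ 'm"
  assumes "orthogonal_proj P" "orthogonal_proj Q"
  shows "hs_inner (embed P) (embed Q) =
    (hs_inner P Q - real (rank P) * real (rank Q) / real CARD('m)) /
    (embed_radius CARD('m) (rank P) * embed_radius CARD('m) (rank Q))"
proof -
  have "hs_inner (P - p *\<^sub>R mat 1) (Q - q *\<^sub>R mat 1)
      = hs_inner P Q - q * rank P - p * rank Q + p * q * CARD('m)" for p q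
    using hs_inner_mat_1_right[OF assms(1)] hs_inner_mat_1_right[OF assms(2)]
    by (simp add: hs_inner_scaleR_left hs_inner_scaleR_right hs_inner_diff_left
        hs_inner_diff_right hs_inner_mat_1_self hs_inner_commute[of "mat 1" Q] algebra_simps)
  from this[of "rank P / CARD('m)" "rank Q / CARD('m)"] show ?thesis
    by (simp add: embed_def hs_inner_scaleR_left hs_inner_scaleR_right mult.commute)
qed

lemma embed_radius_pos: "1 \<le> l \<Longrightarrow> l \<le> m - 1 \<Longrightarrow> 0 < embed_radius m l"
  by (auto simp: embed_radius_def)

lemma hs_inner_embed_self:
  fixes P :: "'a::real_or_complex ^ 'm ^ 'm"
  assumes P: "orthogonal_proj P" and l: "1 \<le> rank P" "rank P \<le> CARD('m) - 1"
  shows "hs_inner (embed P) (embed P) = 1"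
proof -
  have "hs_inner P P = hs_inner P (mat 1)"
    using P by (simp add: hs_inner_def orthogonal_proj_def)
  moreover have "embed_radius CARD('m) (rank P) * embed_radius CARD('m) (rank P)
      = real (rank P) * (real CARD('m) - real (rank P)) / real CARD('m)"
    using l by (simp add: embed_radius_def)
  moreover have "embed_radius CARD('m) (rank P) \<noteq> 0"
    using embed_radius_pos[OF l] by simp
  ultimately show ?thesis
    unfolding hs_inner_embed[OF P P] hs_inner_mat_1_right[OF P]
    by (simp add: field_simps)
qed

lemma self_adjoint_embed: "orthogonal_proj P \<Longrightarrow> self_adjoint (embed P)"
  by (auto simp: embed_def orthogonal_proj_def self_adjoint_nth conj_scaleR conj_diff mat_def
      conj_one conj_zero)

text \<open>For orthogonal subspaces of dimensions \<open>p\<close> and \<open>q\<close> the inner product is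
  \<open>- p q / (m r\<^sub>p r\<^sub>q)\<close>. The bound \<open>r\<^sub>l \<le> l sqrt ((m - 1) / m)\<close>, an equality for lines, shows that
  two lines are the extreme case.\<close>

lemma hs_inner_embed_orthogonal_le:
  fixes P Q :: "'a::real_or_complex ^ 'm ^ 'm"
  assumes P: "orthogonal_proj P" "1 \<le> rank P" "rank P \<le> CARD('m) - 1"
    and Q: "orthogonal_proj Q" "1 \<le> rank Q" "rank Q \<le> CARD('m) - 1"
    and orth: "P ** Q = 0"
  shows "hs_inner (embed P) (embed Q) \<le> - 1 / real (CARD('m) - 1)"
proof -
  let ?m = "CARD('m)"
  have r: "embed_radius ?m l \<le> real l * sqrt (real (?m - 1) / real ?m)" if l: "1 \<le> l" "l \<le> ?m - 1" for l
  proof -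
    have "real ?m - real l \<le> real l * (real ?m - 1)"
    proof -
      have "0 \<le> (real l - 1) * real ?m" using l by (intro mult_nonneg_nonneg) auto
      then show ?thesis by (simp add: algebra_simps)
    qed
    then have "real l * (real ?m - real l) \<le> real l * (real l * (real ?m - 1))"
      by (rule mult_left_mono) simp
    then have "real l * (real ?m - real l) / real ?m \<le> (real l)\<^sup>2 * (real (?m - 1) / real ?m)"
      using l by (simp add: divide_right_mono power2_eq_square of_nat_diff mult.assoc)
    then have "embed_radius ?m l \<le> sqrt ((real l)\<^sup>2 * (real (?m - 1) / real ?m))"
      unfolding embed_radius_def by (rule real_sqrt_le_mono)
    also have "\<dots> = real l * sqrt (real (?m - 1) / real ?m)"
      by (simp only: real_sqrt_mult real_sqrt_abs abs_of_nat)
    finally show ?thesis .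
  qed
  let ?p = "real (rank P)" and ?q = "real (rank Q)"
  let ?r = "embed_radius ?m (rank P)" and ?s = "embed_radius ?m (rank Q)"
  have pos: "0 < ?r" "0 < ?s" using embed_radius_pos P Q by auto
  have "?r * ?s \<le> (?p * sqrt (real (?m - 1) / real ?m)) * (?q * sqrt (real (?m - 1) / real ?m))"
    using r P Q pos by (intro mult_mono) auto
  also have "\<dots> = ?p * ?q * (sqrt (real (?m - 1) / real ?m) * sqrt (real (?m - 1) / real ?m))"
    by (simp only: ac_simps)
  also have "\<dots> = real (?m - 1) * (?p * ?q / real ?m)"
    by simp
  finally have rs: "?r * ?s \<le> real (?m - 1) * (?p * ?q / real ?m)" .
  have m1: "0 < real (?m - 1)" using P by simp
  have flip: "1 / c \<le> y / z" if "0 < z" "0 < c" "z \<le> c * y" for c y z :: real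
    using that by (simp add: field_simps)
  have "hs_inner P Q = 0"
    using re_part_of_real[of 0, where ?'a = 'a] by (simp add: hs_inner_def orth trace_def)
  then have "hs_inner (embed P) (embed Q) = - ((?p * ?q / real ?m) / (?r * ?s))"
    by (simp add: hs_inner_embed P Q)
  moreover have "1 / real (?m - 1) \<le> (?p * ?q / real ?m) / (?r * ?s)"
    using flip[OF mult_pos_pos[OF pos] m1 rs] .
  ultimately show ?thesis by simp
qed

section \<open>Tight pairs of a packing\<close>

definition tight_pairs :: "nat \<Rightarrow> (nat \<Rightarrow> 'a::real_or_complex ^ 'm ^ 'm) \<Rightarrow> real \<Rightarrow> (nat \<times> nat) set" where
  "tight_pairs n P \<mu> = {(i, j). i \<in> {1..n} \<and> j \<in> {1..n} \<and> i \<noteq> j \<and>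
     hs_inner (embed (P i)) (embed (P j)) = \<mu>}"

lemma finite_tight_pairs: "finite (tight_pairs n P \<mu>)"
  by (rule finite_subset[of _ "{1..n} \<times> {1..n}"]) (auto simp: tight_pairs_def)

text \<open>A tight orthogonal pair would force \<open>\<mu> \<le> -1/(m - 1)\<close>. As there are at least \<open>m\<close> members, the
  embedded vectors would form a simplex, so all pairs would be tight and all members would annihilate
  \<open>x\<close>. Applying the vanishing sum of the embedded vectors to \<open>x\<close> leaves only the contributions of
  the subtracted multiples of the identity, which have the same sign and cannot cancel.\<close>

lemma no_orthogonal_tight_pair:
  fixes P :: "nat \<Rightarrow> 'a::real_or_complex ^ 'm ^ 'm"
  assumes n: "CARD('m) \<le> n"
    and P: "\<And>i. i \<in> {1..n} \<Longrightarrow> orthogonal_proj (P i)"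
    and l: "\<And>i. i \<in> {1..n} \<Longrightarrow> 1 \<le> rank (P i) \<and> rank (P i) \<le> CARD('m) - 1"
    and le: "\<And>i j. i \<in> {1..n} \<Longrightarrow> j \<in> {1..n} \<Longrightarrow> i \<noteq> j \<Longrightarrow>
        hs_inner (embed (P i)) (embed (P j)) \<le> \<mu>"
    and x: "x \<noteq> 0" and ker: "\<And>i j. (i, j) \<in> tight_pairs n P \<mu> \<Longrightarrow> P i *v x = 0"
    and ij: "(i, j) \<in> tight_pairs n P \<mu>"
  shows "P i ** P j \<noteq> 0"
proof
  assume orth: "P i ** P j = 0"
  let ?m = "CARD('m)"
  have ij': "i \<in> {1..n}" "j \<in> {1..n}" "i \<noteq> j" "hs_inner (embed (P i)) (embed (P j)) = \<mu>"
    using ij by (auto simp: tight_pairs_def)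
  have m1: "0 < real (?m - 1)" using l[OF ij'(1)] by (cases "CARD('m)") auto
  have "\<mu> \<le> - 1 / real (?m - 1)"
    using hs_inner_embed_orthogonal_le[OF _ _ _ _ _ _ orth] P l ij' by auto
  then have \<mu>: "1 + real (?m - 1) * \<mu> \<le> 0"
    using m1 unfolding pos_le_divide_eq[OF m1] by (simp only: mult.commute)
  have "\<mu> \<le> 0"
    using \<mu> m1 by (smt (verit) mult_nonneg_nonneg)
  then have "real (n - 1) * \<mu> \<le> real (?m - 1) * \<mu>"
    using n by (intro mult_right_mono_neg) auto
  with \<mu> have "1 + real (n - 1) * \<mu> \<le> 0" by linarith
  then have simplex_bound: "1 + real (card {1..n} - 1) * \<mu> \<le> 0" by (simp only: card_atLeastAtMost diff_Suc_1)
  note simplex = simplex_of_small_inner_products[of "{1..n}" "\<lambda>i. embed (P i)" \<mu>,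
      OF self_adjoint_embed[OF P] finite_atLeastAtMost hs_inner_embed_self[OF P] le simplex_bound]
  have sum0: "(\<Sum>i\<in>{1..n}. embed (P i)) = 0"
    using l by (intro simplex(1)) auto
  have all_tight: "hs_inner (embed (P a)) (embed (P b)) = \<mu>"
    if "a \<in> {1..n}" "b \<in> {1..n}" "a \<noteq> b" for a b
    using l that by (intro simplex(2)) auto
  have Px: "P k *v x = 0" if k: "k \<in> {1..n}" for k
  proof -
    obtain k' where k': "k' \<in> {1..n}" "k \<noteq> k'" using ij' by metis
    with k all_tight[of k k'] have "(k, k') \<in> tight_pairs n P \<mu>" by (simp add: tight_pairs_def)
    then show ?thesis by (rule ker)
  qed
  define w where "w k = real (rank (P k)) / real ?m / embed_radius ?m (rank (P k))" for k
  have embed_x: "embed (P k) *v x = - (w k *\<^sub>R x)" if "k \<in> {1..n}" for k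
    using Px[OF that]
    by (simp add: embed_def w_def matrix_vector_mult_diff_rdistrib scaleR_matrix_mult_vector)
  have "0 = (\<Sum>k\<in>{1..n}. embed (P k)) *v x" by (simp only: sum0 matrix_vector_mult_0)
  also have "\<dots> = (\<Sum>k\<in>{1..n}. embed (P k) *v x)"
    by (induction n) (simp_all add: matrix_vector_mult_add_rdistrib)
  also have "\<dots> = - ((\<Sum>k\<in>{1..n}. w k) *\<^sub>R x)"
    by (simp add: embed_x sum_negf scaleR_sum_left)
  finally have "(\<Sum>k\<in>{1..n}. w k) = 0" using x by simp
  moreover have "0 < w k" if "k \<in> {1..n}" for k
    using l[OF that] embed_radius_pos[of "rank (P k)" ?m] by (simp add: w_def)
  then have "0 < (\<Sum>k\<in>{1..n}. w k)"
    using ij' by (intro sum_pos) auto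
  ultimately show False by simp
qed

text \<open>For projections of prescribed rank, a bound on the inner product of the embedded vectors is the bound
  \<open>t k\<close> on the inner product of the projections themselves, so the rotation of projections applies.\<close>

lemma loosen_member_of_tight_pair:
  fixes P :: "nat \<Rightarrow> 'a::real_or_complex ^ 'm ^ 'm"
  assumes P: "\<And>i. i \<in> {1..n} \<Longrightarrow> orthogonal_proj (P i)"
    and l: "\<And>i. i \<in> {1..n} \<Longrightarrow> 1 \<le> rank (P i) \<and> rank (P i) \<le> CARD('m) - 1"
    and le: "\<And>i j. i \<in> {1..n} \<Longrightarrow> j \<in> {1..n} \<Longrightarrow> i \<noteq> j \<Longrightarrow>
        hs_inner (embed (P i)) (embed (P j)) \<le> \<mu>"
    and x: "norm x = 1" and ker: "\<And>i j. (i, j) \<in> tight_pairs n P \<mu> \<Longrightarrow> P i *v x = 0"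
    and nonorth: "\<And>i j. (i, j) \<in> tight_pairs n P \<mu> \<Longrightarrow> P i ** P j \<noteq> 0"
    and ij: "(i, j) \<in> tight_pairs n P \<mu>"
  shows "\<exists>Q. orthogonal_proj Q \<and> rank Q = rank (P j) \<and>
    (\<forall>k\<in>{1..n} - {j}. hs_inner (embed (P k)) (embed Q) < \<mu>)"
proof -
  let ?m = "CARD('m)"
  have ij': "i \<in> {1..n}" "j \<in> {1..n}" "i \<noteq> j" and ji: "(j, i) \<in> tight_pairs n P \<mu>"
    using ij by (auto simp: tight_pairs_def hs_inner_commute)
  define r where "r k = embed_radius ?m (rank (P k))" for k
  have r: "0 < r k" if "k \<in> {1..n}" for k
    using that l embed_radius_pos by (simp add: r_def)
  define t where "t k = \<mu> * (r k * r j) + real (rank (P k)) * real (rank (P j)) / real ?m" for k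
  have embed_iff:
    "hs_inner (embed (P k)) (embed Q) \<le> \<mu> \<longleftrightarrow> hs_inner (P k) Q \<le> t k"
    "hs_inner (embed (P k)) (embed Q) < \<mu> \<longleftrightarrow> hs_inner (P k) Q < t k"
    if "k \<in> {1..n}" "orthogonal_proj Q" "rank Q = rank (P j)" for k Q
    using that P[OF that(1)] mult_pos_pos[OF r[OF that(1)] r[OF ij'(2)]]
    by (auto simp: hs_inner_embed t_def pos_divide_le_eq pos_divide_less_eq simp flip: r_def)
  have tight: "(k, j) \<in> tight_pairs n P \<mu>" if "k \<in> {1..n} - {j}" "hs_inner (P k) (P j) = t k" for k
    using embed_iff[of k "P j"] that P ij' by (auto simp: tight_pairs_def)
  have "P j \<noteq> 0" using nonorth[OF ij] by auto
  have "\<exists>Q. orthogonal_proj Q \<and> rank Q = rank (P j) \<and> (\<forall>k\<in>{1..n} - {j}. hs_inner (P k) Q < t k)"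
  proof (rule rotation_loosens_tight)
    show "orthogonal_proj (P j)" using P ij' by blast
    show "P j *v x = 0" using ker ji by blast
    show "hs_inner (P k) (P j) \<le> t k" if "k \<in> {1..n} - {j}" for k
      using embed_iff(1)[of k "P j"] that P le ij' by auto
    show "P k *v x = 0" if "k \<in> {1..n} - {j}" "hs_inner (P k) (P j) = t k" for k
      using ker tight that by blast
    show "P k ** P j \<noteq> 0" if "k \<in> {1..n} - {j}" "hs_inner (P k) (P j) = t k" for k
      using nonorth tight that by blast
  qed (use P x \<open>P j \<noteq> 0\<close> in auto)
  then show ?thesis using embed_iff(2) by (meson DiffD1)
qed

text \<open>Descent on the number of tight pairs. Replacing the second member of a tight pair by a loosened one
  keeps all hypotheses: the new member belongs to no tight pair, so the tight pairs that remain consist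
  of unchanged members, which annihilate \<open>x\<close>.\<close>

lemma optimal_common_kernel_trivial:
  fixes P :: "nat \<Rightarrow> 'a::real_or_complex ^ 'm ^ 'm"
  assumes n: "CARD('m) \<le> n"
    and l: "\<And>i. i \<in> {1..n} \<Longrightarrow> 1 \<le> l i \<and> l i \<le> CARD('m) - 1"
    and opt: "\<And>Q :: nat \<Rightarrow> 'a ^ 'm ^ 'm. (\<And>i. i \<in> {1..n} \<Longrightarrow> orthogonal_proj (Q i) \<and> rank (Q i) = l i) \<Longrightarrow>
        \<exists>i\<in>{1..n}. \<exists>j\<in>{1..n}. i \<noteq> j \<and> \<mu> \<le> hs_inner (embed (Q i)) (embed (Q j))"
    and x: "norm x = 1"
    and P: "\<And>i. i \<in> {1..n} \<Longrightarrow> orthogonal_proj (P i) \<and> rank (P i) = l i"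
    and le: "\<And>i j. i \<in> {1..n} \<Longrightarrow> j \<in> {1..n} \<Longrightarrow> i \<noteq> j \<Longrightarrow>
        hs_inner (embed (P i)) (embed (P j)) \<le> \<mu>"
    and ker: "\<And>i j. (i, j) \<in> tight_pairs n P \<mu> \<Longrightarrow> P i *v x = 0"
  shows False
  using P le ker
proof (induction P rule: measure_induct_rule[where f = "\<lambda>P. card (tight_pairs n P \<mu>)"])
  case (less P)
  note P = less.prems(1) and le = less.prems(2) and ker = less.prems(3)
  obtain i j where "i \<in> {1..n}" "j \<in> {1..n}" "i \<noteq> j" "\<mu> \<le> hs_inner (embed (P i)) (embed (P j))"
    using opt[OF P] by blast
  with le[of i j] have ij: "(i, j) \<in> tight_pairs n P \<mu>" by (auto simp: tight_pairs_def)
  have rk: "1 \<le> rank (P k) \<and> rank (P k) \<le> CARD('m) - 1" if "k \<in> {1..n}" for k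
    using P[OF that] l[OF that] by simp
  have proj: "orthogonal_proj (P k)" if "k \<in> {1..n}" for k using P[OF that] by simp
  have "x \<noteq> 0" using x by auto
  have nonorth: "P a ** P b \<noteq> 0" if ab: "(a, b) \<in> tight_pairs n P \<mu>" for a b
  proof (rule no_orthogonal_tight_pair[OF n])
    show "P a *v x = 0" if "(a, b) \<in> tight_pairs n P \<mu>" for a b using ker that .
  qed (fact proj rk le \<open>x \<noteq> 0\<close> ab)+
  have "\<exists>Q. orthogonal_proj Q \<and> rank Q = rank (P j) \<and>
      (\<forall>k\<in>{1..n} - {j}. hs_inner (embed (P k)) (embed Q) < \<mu>)"
  proof (rule loosen_member_of_tight_pair)
    show "P a *v x = 0" if "(a, b) \<in> tight_pairs n P \<mu>" for a b using ker that .
  qed (fact proj rk le x nonorth ij)+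
  then obtain Q where Q: "orthogonal_proj Q" "rank Q = rank (P j)"
    and Qless: "\<And>k. k \<in> {1..n} \<Longrightarrow> k \<noteq> j \<Longrightarrow> hs_inner (embed (P k)) (embed Q) < \<mu>"
    by blast
  have Qless': "hs_inner (embed Q) (embed (P k)) < \<mu>" if "k \<in> {1..n}" "k \<noteq> j" for k
    using Qless[OF that] by (simp add: hs_inner_commute)
  have same: "(a, b) \<in> tight_pairs n P \<mu> \<and> a \<noteq> j \<and> b \<noteq> j"
    if "(a, b) \<in> tight_pairs n (P(j := Q)) \<mu>" for a b
    using that Qless[of a] Qless'[of b] by (auto simp: tight_pairs_def split: if_splits)
  show False
  proof (rule less.IH[of "P(j := Q)"])
    have "tight_pairs n (P(j := Q)) \<mu> \<subset> tight_pairs n P \<mu>" using same ij by auto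
    then show "card (tight_pairs n (P(j := Q)) \<mu>) < card (tight_pairs n P \<mu>)"
      using finite_tight_pairs by (rule psubset_card_mono[rotated])
    show "orthogonal_proj ((P(j := Q)) a) \<and> rank ((P(j := Q)) a) = l a" if "a \<in> {1..n}" for a
      using Q P that by auto
    show "hs_inner (embed ((P(j := Q)) a)) (embed ((P(j := Q)) b)) \<le> \<mu>"
      if "a \<in> {1..n}" "b \<in> {1..n}" "a \<noteq> b" for a b
      using that Qless[of a] Qless'[of b] le by auto
    show "(P(j := Q)) a *v x = 0" if "(a, b) \<in> tight_pairs n (P(j := Q)) \<mu>" for a b
      using same[OF that] ker by auto
  qed
qed

section \<open>Optimally spread packings\<close>

lemma finite_inner_products:
  "finite {hs_inner (u i) (u j) | i j. i \<in> {1..n} \<and> j \<in> {1..n} \<and> i \<noteq> (j::nat)}"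
  by (rule finite_subset[of _ "(\<lambda>(i, j). hs_inner (u i) (u j)) ` ({1..n} \<times> {1..n})"]) auto

lemma hs_inner_le_max_inner:
  "i \<in> {1..n} \<Longrightarrow> j \<in> {1..n} \<Longrightarrow> i \<noteq> j \<Longrightarrow> hs_inner (u i) (u j) \<le> max_inner n u"
  unfolding max_inner_def by (rule Max_ge[OF finite_inner_products]) blast

lemma max_inner_attained:
  assumes "2 \<le> n"
  shows "\<exists>i\<in>{1..n}. \<exists>j\<in>{1..n}. i \<noteq> j \<and> hs_inner (u i) (u j) = max_inner n u"
proof -
  have "hs_inner (u 1) (u 2) \<in> {hs_inner (u i) (u j) | i j. i \<in> {1..n} \<and> j \<in> {1..n} \<and> i \<noteq> j}"
    using assms by force
  then have "max_inner n u \<in> {hs_inner (u i) (u j) | i j. i \<in> {1..n} \<and> j \<in> {1..n} \<and> i \<noteq> j}"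
    unfolding max_inner_def by (intro Max_in finite_inner_products) blast
  then show ?thesis by (smt (verit) mem_Collect_eq)
qed

lemma achieving_subspaces_span:
  fixes P :: "nat \<Rightarrow> 'a::real_or_complex ^ 'm ^ 'm"
  assumes n: "CARD('m) \<le> n" "2 \<le> n"
    and l: "\<forall>i\<in>{1..n}. 1 \<le> l i \<and> l i \<le> CARD('m) - 1"
    and P: "packing n P" and opt: "optimally_spread n P" and rk: "\<forall>i\<in>{1..n}. rank (P i) = l i"
  shows "vec.span (\<Union>i\<in>{i\<in>{1..n}. achieves_constant n P i}. range ((*v) (P i))) = UNIV"
proof (rule ccontr)
  let ?I = "{i \<in> {1..n}. achieves_constant n P i}" and ?\<mu> = "packing_constant n P"
  assume "vec.span (\<Union>i\<in>?I. range ((*v) (P i))) \<noteq> UNIV"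
  moreover have "self_adjoint (P i)" if "i \<in> ?I" for i
    using P that by (simp add: packing_def orthogonal_proj_def)
  ultimately obtain x where x: "norm x = 1" "\<And>i. i \<in> ?I \<Longrightarrow> P i *v x = 0"
    using exists_common_kernel_vector[of ?I P] by blast
  show False
  proof (rule optimal_common_kernel_trivial[OF n(1), where \<mu> = ?\<mu> and P = P and x = x and l = l])
    fix Q :: "nat \<Rightarrow> 'a ^ 'm ^ 'm"
    assume "\<And>i. i \<in> {1..n} \<Longrightarrow> orthogonal_proj (Q i) \<and> rank (Q i) = l i"
    then have "(\<lambda>i. embed (Q i)) \<in> Pi {1..n} (\<lambda>i. embed_proj_set (rank (P i)))"
      using rk by (auto simp: embed_proj_set_def)
    then have "?\<mu> \<le> max_inner n (\<lambda>i. embed (Q i))"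
      using opt by (simp add: optimally_spread_def)
    then show "\<exists>i\<in>{1..n}. \<exists>j\<in>{1..n}. i \<noteq> j \<and> ?\<mu> \<le> hs_inner (embed (Q i)) (embed (Q j))"
      using max_inner_attained[OF n(2), of "\<lambda>i. embed (Q i)"] by metis
  next
    show "hs_inner (embed (P i)) (embed (P j)) \<le> ?\<mu>" if "i \<in> {1..n}" "j \<in> {1..n}" "i \<noteq> j" for i j
      unfolding packing_constant_def
      using hs_inner_le_max_inner[OF that, of "\<lambda>i. embed (P i)"] .
    show "P i *v x = 0" if "(i, j) \<in> tight_pairs n P ?\<mu>" for i j
      using that by (intro x(2)) (auto simp: tight_pairs_def achieves_constant_def)
  qed (use l P rk x in \<open>auto simp: packing_def\<close>)
qed

theorem theorem5p1:
  fixes n :: nat and l :: "nat \<Rightarrow> nat"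
  assumes "n \<ge> CARD('m)"
    and "\<forall>i\<in>{1..n}. 1 \<le> l i \<and> l i \<le> CARD('m) - 1"
  shows
    "(\<forall>P :: nat \<Rightarrow> real ^ 'm ^ 'm.
        packing n P \<and> mixed_rank n P \<and> optimally_spread n P \<and> (\<forall>i\<in>{1..n}. rank (P i) = l i)
        \<longrightarrow> vec.span (\<Union>i\<in>{i\<in>{1..n}. achieves_constant n P i}. range ((*v) (P i))) = UNIV) \<and>
     (\<forall>P :: nat \<Rightarrow> complex ^ 'm ^ 'm.
        packing n P \<and> mixed_rank n P \<and> optimally_spread n P \<and> (\<forall>i\<in>{1..n}. rank (P i) = l i)
        \<longrightarrow> vec.span (\<Union>i\<in>{i\<in>{1..n}. achieves_constant n P i}. range ((*v) (P i))) = UNIV)"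
proof -
  \<comment> \<open>The maximum of the inner products ranges over a nonempty set only if there are two members;
    the rank condition on the first member gives \<open>m \<ge> 2\<close> and hence \<open>n \<ge> 2\<close>.\<close>
  have "0 < CARD('m)" by simp
  then have "1 \<in> {1..n}" using assms(1) by (simp del: zero_less_card_finite)
  then have "1 \<le> CARD('m) - 1" using assms(2) le_trans by blast
  then have "2 \<le> n" using assms(1) by linarith
  note span = achieving_subspaces_span[OF assms(1) \<open>2 \<le> n\<close> assms(2)]
  show ?thesis by (intro conjI allI impI; elim conjE; rule span; assumption)
qed

end
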